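(* Let $\Gamma$ be a graph, and let $\Gamma'$ be a finite subgraph of $\Gamma$ with all vertices of degree (in $\Gamma'$) at least two. Assume that - the girth of $\Gamma$ is $\geq 2\pi$, and - each two points $x,y$ in $\Gamma'$ are at distance $\leq \pi$ in $\Gamma$. Then all cycles and segments of $\Gamma'$ have length commensurable with $\pi$.
   Context: By a graph is meant a (possibly infinite) metric graph with finitely many possible edge lengths. The girth is the minimal length of a cycle. A cycle of a graph $\Lambda$ is a closed edge-path embedded in $\Lambda$. An embedded edge-path $P$ in $\Lambda$ is a segment of $\Lambda$ if the endpoints of $P$ have degree (valence) at least three in $\Lambda$, but every internal vertex of $P$ has degree two in $\Lambda$. The points $x,y$ are arbitrary points of the metric graph $\Gamma'$ (not only vertices), and distance in $\Gamma$ is the length (path) metric. A length is commensurable with $\pi$ if it is a rational multiple of $\pi$. *)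

theory Defs
  imports Complex_Main "HOL-Library.Extended_Real" "Graph_Theory.Graph_Theory"
begin

text \<open>
  A graph (loops and multiple edges allowed) is represented by a \<open>pre_digraph\<close> in which every
  edge occurs exactly once, with an arbitrarily chosen orientation. The orientation serves only
  to parametrise the edge \<open>e\<close> by the interval from \<open>0\<close> (at the tail) to \<open>len e\<close> (at the head).
\<close>

locale metric_graph = wf_digraph G for G :: "('v, 'e) pre_digraph" +
  fixes len :: "'e \<Rightarrow> real"
  assumes len_pos: "e \<in> arcs G \<Longrightarrow> 0 < len e"
    and finite_lengths: "finite (len ` arcs G)"

text \<open>A loop contributes two to the degree. The value is only meaningful for finite degrees.\<close>

definition graph_degree :: "('v, 'e) pre_digraph \<Rightarrow> 'v \<Rightarrow> nat" where
  "graph_degree G v = in_degree G v + out_degree G v"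

text \<open>
  Edge-paths may traverse an edge in either direction: they are the directed walks in the
  following digraph, where \<open>(e, True)\<close> follows the chosen orientation of \<open>e\<close> and
  \<open>(e, False)\<close> the opposite one.
\<close>

definition darts :: "('v, 'e) pre_digraph \<Rightarrow> ('v, 'e \<times> bool) pre_digraph" where
  "darts G = \<lparr> verts = verts G, arcs = arcs G \<times> UNIV,
     tail = (\<lambda>(e, b). if b then tail G e else head G e),
     head = (\<lambda>(e, b). if b then head G e else tail G e) \<rparr>"

definition edge_path_length :: "('e \<Rightarrow> real) \<Rightarrow> ('e \<times> bool) list \<Rightarrow> real" where
  "edge_path_length len p = (\<Sum>d\<leftarrow>p. len (fst d))"

text \<open>
  The distinctness of the underlying edges excludes going back and forth along one edge, which
  is a directed cycle of length two in \<open>darts G\<close>. Loops and pairs of parallel edges are cycles.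
\<close>

definition graph_cycle :: "('v, 'e) pre_digraph \<Rightarrow> ('e \<times> bool) list \<Rightarrow> bool" where
  "graph_cycle G p \<longleftrightarrow> pre_digraph.cycle (darts G) p \<and> distinct (map fst p)"

text \<open>The girth is \<open>\<infinity>\<close> if there are no cycles.\<close>

definition girth :: "('v, 'e) pre_digraph \<Rightarrow> ('e \<Rightarrow> real) \<Rightarrow> ereal" where
  "girth G len = (INF p \<in> {p. graph_cycle G p}. ereal (edge_path_length len p))"

definition graph_segment :: "('v, 'e) pre_digraph \<Rightarrow> ('e \<times> bool) list \<Rightarrow> bool" where
  "graph_segment G p \<longleftrightarrow> p \<noteq> [] \<and>
     (\<exists>u v. pre_digraph.apath (darts G) u p v \<and> 3 \<le> graph_degree G u \<and> 3 \<le> graph_degree G v \<and>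
        (\<forall>w \<in> set (pre_digraph.inner_verts (darts G) p). graph_degree G w = 2))"

text \<open>
  The points of the metric graph: vertices and interior points of edges, \<open>Inner e t\<close> being the
  point of \<open>e\<close> at distance \<open>t\<close> along \<open>e\<close> from its tail.
\<close>

datatype ('v, 'e) graph_point = Vertex 'v | Inner 'e real

definition graph_points :: "('v, 'e) pre_digraph \<Rightarrow> ('e \<Rightarrow> real) \<Rightarrow> ('v, 'e) graph_point set" where
  "graph_points G len = Vertex ` verts G \<union> {Inner e t | e t. e \<in> arcs G \<and> 0 < t \<and> t < len e}"

definition edge_point :: "('v, 'e) pre_digraph \<Rightarrow> ('e \<Rightarrow> real) \<Rightarrow> 'e \<Rightarrow> real \<Rightarrow> ('v, 'e) graph_point" where
  "edge_point G len e t =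
     (if t \<le> 0 then Vertex (tail G e) else if len e \<le> t then Vertex (head G e) else Inner e t)"

text \<open>
  \<open>pl_path G len x y l\<close>: there is a piecewise linear path of length \<open>l\<close> from \<open>x\<close> to \<open>y\<close>,
  i.e. a finite concatenation of linear pieces, each running inside a closed edge. The path
  metric is the infimum of their lengths, and is \<open>\<infinity>\<close> between different components.
\<close>

inductive pl_path :: "('v, 'e) pre_digraph \<Rightarrow> ('e \<Rightarrow> real) \<Rightarrow>
    ('v, 'e) graph_point \<Rightarrow> ('v, 'e) graph_point \<Rightarrow> real \<Rightarrow> bool"
  for G len where
  const: "x \<in> graph_points G len \<Longrightarrow> pl_path G len x x 0"
| step: "\<lbrakk>pl_path G len x (edge_point G len e s) l; e \<in> arcs G; s \<in> {0..len e}; t \<in> {0..len e}\<rbrakk>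
    \<Longrightarrow> pl_path G len x (edge_point G len e t) (l + \<bar>s - t\<bar>)"

definition path_dist :: "('v, 'e) pre_digraph \<Rightarrow> ('e \<Rightarrow> real) \<Rightarrow>
    ('v, 'e) graph_point \<Rightarrow> ('v, 'e) graph_point \<Rightarrow> ereal" where
  "path_dist G len x y = (INF l \<in> {l. pl_path G len x y l}. ereal l)"

definition commensurable_pi :: "real \<Rightarrow> bool" where
  "commensurable_pi l \<longleftrightarrow> (\<exists>q \<in> \<rat>. l = q * pi)"

end

(*
  For vertices x, y write r(x, y) = pi - d(x, y). The girth bound makes geodesics shorter than pi
  unique. Hence, for an edge a = x x' and a vertex y of Gamma', either one of the geodesics from
  x and x' to y runs through a, and len a = +-(r(x', y) - r(x, y)), or a contains a point antipodal
  to y, and len a = r(x, y) + r(x', y). In the latter case the diameter bound, applied to points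
  near y, leaves room for only two directions of Gamma' at y.

  Let E be the total length of Gamma' and let Phi be a Q-linear map of the reals that fixes pi.
  Expanding Phi(E)^2 by means of these relations, once in x and once in y, all products
  Phi(r(x, y)) * Phi(r(x', y)) cancel except those with y in {x, x'}, and

    Phi(E)^2 - 2 * pi * Phi(E) = a combination of squares with nonnegative coefficients.

  If E were incommensurable with pi one could choose Phi(E) = pi, which makes the left-hand side
  negative. So the total length of Gamma' is commensurable with pi. The argument applies to every
  subgraph of Gamma' with all degrees at least two: a cycle is such a subgraph, and a segment is
  the difference of two of them.
*)
theory Submission
  imports Defs
begin

section \<open>Darts and reduced walks\<close>

lemma darts_simps [simp]:
  "verts (darts G) = verts G"
  "arcs (darts G) = arcs G \<times> UNIV"
  "tail (darts G) (e, b) = (if b then tail G e else head G e)"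
  "head (darts G) (e, b) = (if b then head G e else tail G e)"
  by (simp_all add: darts_def)

definition rev_dart :: "'e \<times> bool \<Rightarrow> 'e \<times> bool" where
  "rev_dart d = (fst d, \<not> snd d)"

lemma rev_dart_simps [simp]:
  "fst (rev_dart d) = fst d"
  "rev_dart (rev_dart d) = d"
  "rev_dart d \<noteq> d" "d \<noteq> rev_dart d"
  "tail (darts G) (rev_dart d) = head (darts G) d"
  "head (darts G) (rev_dart d) = tail (darts G) d"
  "rev_dart d \<in> F \<times> UNIV \<longleftrightarrow> d \<in> F \<times> UNIV"
  by (cases d; auto simp: rev_dart_def)+

lemma rev_dart_eq_iff [simp]: "rev_dart a = rev_dart b \<longleftrightarrow> a = b"
  by (metis rev_dart_simps(2))

lemma fst_dart_eq_iff: "fst a = fst b \<longleftrightarrow> a = b \<or> a = rev_dart b"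
  by (cases a; cases b) (auto simp: rev_dart_def)

definition rev_walk :: "('e \<times> bool) list \<Rightarrow> ('e \<times> bool) list" where
  "rev_walk p = rev (map rev_dart p)"

definition reduced :: "('e \<times> bool) list \<Rightarrow> bool" where
  "reduced p \<longleftrightarrow> successively (\<lambda>a b. b \<noteq> rev_dart a) p"

lemma rev_walk_simps [simp]:
  "rev_walk [] = []" "rev_walk (a # p) = rev_walk p @ [rev_dart a]"
  "rev_walk p = [] \<longleftrightarrow> p = []"
  by (simp_all add: rev_walk_def)

lemma reduced_simps [simp]:
  "reduced []" "reduced [a]"
  "reduced (a # b # p) \<longleftrightarrow> b \<noteq> rev_dart a \<and> reduced (b # p)"
  by (simp_all add: reduced_def)

lemma reduced_append_iff:
  "reduced (p @ q) \<longleftrightarrow>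
     reduced p \<and> reduced q \<and> (p = [] \<or> q = [] \<or> hd q \<noteq> rev_dart (last p))"
  by (auto simp: reduced_def successively_append_iff)

lemma reduced_Cons_iff:
  "reduced (a # p) \<longleftrightarrow> reduced p \<and> (p = [] \<or> hd p \<noteq> rev_dart a)"
  by (cases p) auto

lemma last_rev_walk: "p \<noteq> [] \<Longrightarrow> last (rev_walk p) = rev_dart (hd p)"
  by (simp add: rev_walk_def last_rev list.map_sel)

lemma reduced_rev_walk [simp]: "reduced (rev_walk p) \<longleftrightarrow> reduced p"
  by (induction p) (auto simp: reduced_append_iff reduced_Cons_iff last_rev_walk)

lemma edge_path_length_simps [simp]:
  "edge_path_length len [] = 0"
  "edge_path_length len (a # p) = len (fst a) + edge_path_length len p"
  "edge_path_length len (p @ q) = edge_path_length len p + edge_path_length len q"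
  "edge_path_length len (rev_walk p) = edge_path_length len p"
  by (induction p) (simp_all add: edge_path_length_def)

lemma edge_path_length_distinct:
  "distinct (map fst p) \<Longrightarrow> edge_path_length len p = sum len (fst ` set p)"
  using sum_list_distinct_conv_sum_set[of "map fst p" len]
  by (simp add: edge_path_length_def comp_def)

lemma wf_digraph_darts: "wf_digraph G \<Longrightarrow> wf_digraph (darts G)"
  by unfold_locales (auto simp: wf_digraph.tail_in_verts wf_digraph.head_in_verts split: if_splits)

section \<open>Distances between vertices\<close>

context metric_graph
begin

sublocale D: wf_digraph "darts G"
  by (rule wf_digraph_darts) unfold_locales

abbreviation src :: "'e \<times> bool \<Rightarrow> 'v" where "src \<equiv> tail (darts G)"

abbreviation tgt :: "'e \<times> bool \<Rightarrow> 'v" where "tgt \<equiv> head (darts G)"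

abbreviation linked :: "'v \<Rightarrow> 'v \<Rightarrow> bool" where
  "linked u v \<equiv> \<exists>p. D.awalk u p v"

text \<open>Being real-valued, this is meaningful only for linked vertices; the infimum of the empty
  set is an unspecified number.\<close>

definition vdist :: "'v \<Rightarrow> 'v \<Rightarrow> real" where
  "vdist u v = Inf (edge_path_length len ` {p. D.awalk u p v})"

lemma edge_path_length_nonneg: "set p \<subseteq> arcs (darts G) \<Longrightarrow> 0 \<le> edge_path_length len p"
  by (induction p) (auto intro!: add_nonneg_nonneg less_imp_le[OF len_pos])

lemma edge_path_length_pos:
  assumes "set p \<subseteq> arcs (darts G)" "p \<noteq> []" shows "0 < edge_path_length len p"
  using assms edge_path_length_nonneg[of "tl p"]
  by (cases p) (auto intro!: add_pos_nonneg len_pos)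

lemma awalk_rev_walk: "D.awalk u p v \<Longrightarrow> D.awalk v (rev_walk p) u"
proof (induction p arbitrary: u)
  case Nil
  then show ?case by (auto simp: D.awalk_Nil_iff)
next
  case (Cons a p)
  then have "D.awalk v (rev_walk p) (tgt a)" "a \<in> arcs (darts G)" "u = src a"
    by (auto simp: D.awalk_Cons_iff)
  moreover have "D.awalk (tgt a) [rev_dart a] u"
    using calculation D.arc_implies_awalk[of "rev_dart a"]
    by (simp add: mem_Times_iff)
  ultimately show ?case by (simp add: D.awalk_appendI del: D.awalk_append_iff)
qed

text \<open>The finitely many edge lengths have a positive lower bound \<open>m\<close>, so at most
  \<open>c / m\<close> darts fit into length \<open>c\<close>, and only finitely many sums can
  occur. This replaces local finiteness of the graph.\<close>

lemma finite_short_lengths: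
  "finite {edge_path_length len p |p. set p \<subseteq> arcs (darts G) \<and> edge_path_length len p \<le> c}"
    (is "finite ?S")
proof -
  define L where "L = len ` arcs G"
  have finL: "finite L" and posL: "\<And>l. l \<in> L \<Longrightarrow> 0 < l"
    using finite_lengths len_pos by (auto simp: L_def)
  \<comment> \<open>Without edges any positive number serves as \<open>m\<close>.\<close>
  obtain m where m: "0 < m" "\<And>l. l \<in> L \<Longrightarrow> m \<le> l"
  proof (cases "L = {}")
    case True then show ?thesis using that[of 1] by simp
  next
    case False then show ?thesis using that[of "Min L"] finL posL by simp
  qed
  have "?S \<subseteq> sum_list ` {xs. set xs \<subseteq> L \<and> length xs \<le> nat \<lfloor>c / m\<rfloor>}"
  proof
    fix s assume "s \<in> ?S"
    then obtain p where p: "s = edge_path_length len p" "set p \<subseteq> arcs (darts G)" "s \<le> c" by auto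
    define xs where "xs = map (\<lambda>d. len (fst d)) p"
    have xs: "s = sum_list xs" "set xs \<subseteq> L" using p by (auto simp: xs_def edge_path_length_def L_def)
    have "real (length xs) * m \<le> sum_list xs"
      using xs(2) by (induction xs) (auto simp: algebra_simps intro!: add_mono m(2))
    then have "real (length xs) \<le> c / m" using xs p m by (simp add: field_simps)
    then have "length xs \<le> nat \<lfloor>c / m\<rfloor>" by linarith
    then show "s \<in> sum_list ` {xs. set xs \<subseteq> L \<and> length xs \<le> nat \<lfloor>c / m\<rfloor>}" using xs by blast
  qed
  then show ?thesis by (rule finite_subset) (intro finite_imageI finite_lists_length_le finL)
qed

lemma vdist_le: "D.awalk u p v \<Longrightarrow> vdist u v \<le> edge_path_length len p"
  unfolding vdist_def
  by (rule cInf_lower) (auto intro!: bdd_belowI[of _ 0] edge_path_length_nonneg)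

text \<open>Only finitely many lengths lie below that of a given walk, so the infimum is a minimum
  and geodesics exist.\<close>

lemma vdist_attained:
  assumes "linked u v"
  obtains p where "D.awalk u p v" "edge_path_length len p = vdist u v"
proof -
  let ?S = "edge_path_length len ` {p. D.awalk u p v}"
  obtain q where q: "D.awalk u q v" using assms by blast
  define T where "T = {s \<in> ?S. s \<le> edge_path_length len q}"
  have "finite T"
    by (rule finite_subset[OF _ finite_short_lengths[of "edge_path_length len q"]])
      (fastforce simp: T_def D.awalk_def)
  moreover have "edge_path_length len q \<in> T" using q by (auto simp: T_def)
  ultimately have *: "Min T \<in> T" "\<And>s. s \<in> T \<Longrightarrow> Min T \<le> s"
    by (auto intro: Min_in)
  have "Min T \<le> s" if "s \<in> ?S" for s
    using that * by (cases "s \<le> edge_path_length len q") (auto simp: T_def)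
  then have "Inf ?S = Min T" using *(1) by (intro cInf_eq_minimum) (auto simp: T_def)
  moreover from *(1) have "Min T \<in> ?S" by (auto simp: T_def)
  ultimately show ?thesis using that by (auto simp: vdist_def)
qed

lemma linked_sym: "linked u v \<Longrightarrow> linked v u"
  using awalk_rev_walk by blast

lemma linked_trans: "linked u v \<Longrightarrow> linked v w \<Longrightarrow> linked u w"
  by (meson D.awalk_appendI)

lemma linked_dart: "a \<in> arcs (darts G) \<Longrightarrow> linked (src a) (tgt a)"
  using D.arc_implies_awalk by blast

lemma vdist_commute: "vdist u v = vdist v u"
proof -
  have "edge_path_length len ` {p. D.awalk u p v} \<subseteq> edge_path_length len ` {p. D.awalk v p u}" for u v
    by (auto intro!: image_eqI[of _ _ "rev_walk _"] awalk_rev_walk)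
  then show ?thesis unfolding vdist_def by (metis subset_antisym)
qed

lemma vdist_nonneg: "linked u v \<Longrightarrow> 0 \<le> vdist u v"
  by (metis vdist_attained edge_path_length_nonneg D.awalkE')

lemma vdist_self:
  assumes "u \<in> verts G" shows "vdist u u = 0"
proof -
  have "D.awalk u [] u" using assms by (simp add: D.awalk_Nil_iff)
  from vdist_le[OF this] vdist_nonneg[of u u] this show ?thesis by fastforce
qed

lemma vdist_step:
  assumes "a \<in> arcs (darts G)" "linked (tgt a) v"
  shows "vdist (src a) v \<le> len (fst a) + vdist (tgt a) v"
proof -
  obtain p where p: "D.awalk (tgt a) p v" "edge_path_length len p = vdist (tgt a) v"
    using vdist_attained[OF assms(2)] .
  then have "D.awalk (src a) (a # p) v" using assms by (simp add: D.awalk_Cons_iff)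
  from vdist_le[OF this] p show ?thesis by simp
qed

text \<open>Deleting a backtrack \<open>d\<close>, \<open>rev_dart d\<close> keeps the ends and
  shortens the walk.\<close>

lemma shortest_reduced:
  assumes "D.awalk u p v" "edge_path_length len p = vdist u v"
  shows "reduced p"
proof (rule ccontr)
  assume "\<not> reduced p"
  moreover have "\<exists>q d r. p = q @ d # rev_dart d # r" if "\<not> reduced p" for p :: "('e \<times> bool) list"
    using that
  proof (induction p)
    case (Cons a p)
    show ?case
    proof (cases "reduced p")
      case True
      then have "p \<noteq> []" "hd p = rev_dart a" using Cons.prems by (auto simp: reduced_Cons_iff)
      then have "a # p = [] @ a # rev_dart a # tl p" by (cases p) auto
      then show ?thesis by blast
    next
      case False
      then obtain q d r where "p = q @ d # rev_dart d # r" using Cons.IH by blast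
      then have "a # p = (a # q) @ d # rev_dart d # r" by simp
      then show ?thesis by blast
    qed
  qed simp
  ultimately obtain q d r where p: "p = q @ d # rev_dart d # r" by blast
  then have "D.awalk u (q @ r) v" "fst d \<in> arcs G" using assms(1)
    by (auto simp: D.awalk_Cons_iff)
  then show False using vdist_le[of u "q @ r" v] assms(2) len_pos p by fastforce
qed

lemma vdist_triangle:
  assumes "linked u v" "linked v w"
  shows "vdist u w \<le> vdist u v + vdist v w"
proof -
  obtain p where p: "D.awalk u p v" "edge_path_length len p = vdist u v"
    using vdist_attained[OF assms(1)] .
  obtain q where q: "D.awalk v q w" "edge_path_length len q = vdist v w"
    using vdist_attained[OF assms(2)] .
  from vdist_le[OF D.awalk_appendI[OF p(1) q(1)]] p q show ?thesis by simp
qed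

text \<open>With distinct sources an edge can recur only in the opposite direction. The reversed
  dart starts where the successor of \<open>a\<close> starts, hence is that successor, and the walk
  backtracks.\<close>

lemma reduced_distinct_edges:
  assumes "D.awalk u p v" "reduced p" "distinct (map (src) p)"
  shows "distinct (map fst p)"
  using assms
proof (induction p arbitrary: u)
  case (Cons a p)
  have *: "fst d \<noteq> fst a" if "d \<in> set p" for d
  proof
    assume "fst d = fst a"
    moreover have "d \<noteq> a" using that Cons.prems(3) by auto
    ultimately have d: "d = rev_dart a" by (simp add: fst_dart_eq_iff)
    from \<open>d \<in> set p\<close> obtain b q where p: "p = b # q" by (cases p) auto
    have "src b = src d"
      using Cons.prems(1) by (simp add: p d D.awalk_Cons_iff)
    then have "d = b" using that Cons.prems(3) by (auto simp: p)
    then show False using Cons.prems(2) d p by simp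
  qed
  have "distinct (map fst p)"
    using Cons.IH[of "tgt a"] Cons.prems by (auto simp: D.awalk_Cons_iff reduced_Cons_iff)
  moreover have "fst a \<notin> fst ` set p" using * by (metis imageE)
  ultimately show ?case by simp
qed simp

section \<open>Paths between arbitrary points\<close>

text \<open>The points at which a path issuing from \<open>X\<close> can leave the open edge containing \<open>X\<close>, with
  their distances to \<open>X\<close> along that edge.\<close>

definition exits :: "('v, 'e) graph_point \<Rightarrow> ('v \<times> real) set" where
  "exits X = (case X of Vertex v \<Rightarrow> {(v, 0)}
     | Inner e t \<Rightarrow> {(tail G e, t), (head G e, len e - t)})"

lemma exits_simps [simp]:
  "exits (Vertex v) = {(v, 0)}"
  "exits (Inner e t) = {(tail G e, t), (head G e, len e - t)}"
  by (simp_all add: exits_def)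

text \<open>Routes leave \<open>X\<close> by an exit, follow a geodesic between vertices and enter
  \<open>Y\<close> by an exit. They give finitely many values, against which all paths can be
  compared.\<close>

definition route_lengths :: "('v, 'e) graph_point \<Rightarrow> ('v, 'e) graph_point \<Rightarrow> real set" where
  "route_lengths X Y =
     {s + vdist v w + t |v s w t. (v, s) \<in> exits X \<and> (w, t) \<in> exits Y \<and> linked v w}"

lemma route_lengthsI:
  "(v, s) \<in> exits X \<Longrightarrow> (w, t) \<in> exits Y \<Longrightarrow> linked v w \<Longrightarrow> s + vdist v w + t \<in> route_lengths X Y"
  unfolding route_lengths_def mem_Collect_eq
  by (rule exI[of _ v], rule exI[of _ s], rule exI[of _ w], rule exI[of _ t]) simp

lemma finite_route_lengths: "finite (route_lengths X Y)"
proof -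
  have "finite (exits Z)" for Z by (cases Z) auto
  then have "finite ((\<lambda>((v, s), (w, t)). s + vdist v w + t) ` (exits X \<times> exits Y))" by blast
  then show ?thesis
    by (rule finite_subset[rotated])
      (auto simp: route_lengths_def intro!: image_eqI[of _ _ "((_, _), (_, _))"])
qed

lemma linked_refl: "v \<in> verts G \<Longrightarrow> linked v v"
  using D.awalk_Nil_iff by fastforce

lemma linked_arc: "e \<in> arcs G \<Longrightarrow> linked (tail G e) (head G e)"
  using linked_dart[of "(e, True)"] by simp

lemma vdist_arc: "e \<in> arcs G \<Longrightarrow> vdist (tail G e) (head G e) \<le> len e"
  using vdist_step[of "(e, True)" "head G e"] linked_refl[of "head G e"] vdist_self[of "head G e"]
  by simp

text \<open>The inductive step for a path that ends with a piece of \<open>e\<close>: a route to the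
  old end point becomes a route to the new one, longer by at most the piece. The exit may have to
  change, since either point can be a vertex.\<close>

lemma exits_edge_point_step:
  assumes "e \<in> arcs G" "s \<in> {0..len e}" "t \<in> {0..len e}" "(w, r) \<in> exits (edge_point G len e s)"
  shows "\<exists>(w', r') \<in> exits (edge_point G len e t). linked w w' \<and> vdist w w' + r' \<le> r + \<bar>s - t\<bar>"
proof -
  have "tail G e \<in> verts G" "head G e \<in> verts G" using assms(1) by auto
  note * = linked_refl[OF this(1)] linked_refl[OF this(2)] vdist_self[OF this(1)]
    vdist_self[OF this(2)] linked_arc[OF assms(1)] linked_sym[OF linked_arc[OF assms(1)]]
    vdist_arc[OF assms(1)] vdist_arc[OF assms(1), unfolded vdist_commute[of "tail G e"]]
  show ?thesis
    using assms(2-4) * by (auto simp: edge_point_def split: if_splits)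
qed

text \<open>Induction along the path. The second alternative accounts for paths that have not yet
  left the open edge of \<open>X\<close>.\<close>

lemma pl_path_route:
  assumes "pl_path G len X Y l"
  shows "(\<exists>m \<in> route_lengths X Y. m \<le> l) \<or> (\<exists>e s t. X = Inner e s \<and> Y = Inner e t \<and> \<bar>s - t\<bar> \<le> l)"
  using assms
proof induction
  case (const X)
  show ?case
  proof (cases X)
    case (Vertex v)
    then have "v \<in> verts G" using const by (auto simp: graph_points_def)
    then have "0 \<in> route_lengths X X"
      using route_lengthsI[of v 0 X v 0 X] by (simp add: Vertex linked_refl vdist_self)
    then show ?thesis by auto
  qed auto
next
  case (step X e s l t)
  from step.IH show ?case
  proof
    assume "\<exists>m \<in> route_lengths X (edge_point G len e s). m \<le> l"
    then obtain u q w r where *: "(u, q) \<in> exits X" "(w, r) \<in> exits (edge_point G len e s)"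
        "linked u w" "q + vdist u w + r \<le> l"
      unfolding route_lengths_def by blast
    from exits_edge_point_step[OF step.hyps(2-4) *(2)] obtain w' r' where
      w': "(w', r') \<in> exits (edge_point G len e t)" "linked w w'" "vdist w w' + r' \<le> r + \<bar>s - t\<bar>"
      by blast
    have "q + vdist u w' + r' \<in> route_lengths X (edge_point G len e t)"
      using *(1) w'(1) linked_trans[OF *(3) w'(2)] by (rule route_lengthsI)
    moreover have "q + vdist u w' + r' \<le> l + \<bar>s - t\<bar>"
      using vdist_triangle[OF *(3) w'(2)] *(4) w'(3) by simp
    ultimately show ?thesis by blast
  next
    assume "\<exists>e' s' t'. X = Inner e' s' \<and> edge_point G len e s = Inner e' t' \<and> \<bar>s' - t'\<bar> \<le> l"
    then obtain s' where X: "X = Inner e s'" "\<bar>s' - s\<bar> \<le> l"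
      by (auto simp: edge_point_def split: if_splits)
    have "tail G e \<in> verts G" "head G e \<in> verts G" using step.hyps(2) by auto
    \<comment> \<open>These two routes serve if \<open>t\<close> is an end of \<open>e\<close>,
      where the path first reaches a vertex.\<close>
    then have "s' \<in> route_lengths X (Vertex (tail G e))"
      "len e - s' \<in> route_lengths X (Vertex (head G e))"
      using route_lengthsI[of "tail G e" s' X "tail G e" 0 "Vertex (tail G e)"]
        route_lengthsI[of "head G e" "len e - s'" X "head G e" 0 "Vertex (head G e)"]
      by (simp_all add: X linked_refl vdist_self)
    moreover have "s' \<le> l + \<bar>s - 0\<bar>" "len e - s' \<le> l + \<bar>s - len e\<bar>" "\<bar>s' - t\<bar> \<le> l + \<bar>s - t\<bar>"
      using X(2) step.hyps(3) by auto
    ultimately show ?thesis using X step.hyps(4)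
      by (cases "t = 0"; cases "t = len e") (auto simp: edge_point_def)
  qed
qed

lemma path_dist_route:
  assumes "path_dist G len X Y \<le> ereal c" "\<nexists>e s t. X = Inner e s \<and> Y = Inner e t"
  shows "\<exists>m \<in> route_lengths X Y. m \<le> c"
proof (rule ccontr)
  assume "\<not> ?thesis"
  then have gt: "\<And>m. m \<in> route_lengths X Y \<Longrightarrow> c < m" by force
  \<comment> \<open>If there are no routes, there are no paths either, and any number above
    \<open>c\<close> is a lower bound for their lengths.\<close>
  define M where "M = (if route_lengths X Y = {} then c + 1 else Min (route_lengths X Y))"
  have "c < M" using gt finite_route_lengths[of X Y] by (simp add: M_def)
  have "ereal M \<le> path_dist G len X Y"
    unfolding path_dist_def
  proof (rule INF_greatest)
    fix l assume "l \<in> {l. pl_path G len X Y l}"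
    then obtain m where "m \<in> route_lengths X Y" "m \<le> l"
      using pl_path_route[of X Y l] assms(2) by blast
    then show "ereal M \<le> ereal l"
      using Min_le[OF finite_route_lengths, of m X Y] by (auto simp: M_def)
  qed
  with assms(1) have "ereal M \<le> ereal c" by (rule order_trans[rotated])
  with \<open>c < M\<close> show False by simp
qed

section \<open>Uniqueness of short geodesics\<close>

text \<open>At distance exactly \<open>\<pi>\<close>, where geodesics need not be unique, no dart is a first step.\<close>

definition first_step :: "'e \<times> bool \<Rightarrow> 'v \<Rightarrow> bool" where
  "first_step a v \<longleftrightarrow> vdist (src a) v < pi \<and>
     vdist (src a) v = len (fst a) + vdist (tgt a) v"

lemma first_step_exists:
  assumes "linked u v" "u \<noteq> v" "vdist u v < pi"
  obtains a where "a \<in> arcs (darts G)" "src a = u" "first_step a v"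
proof -
  obtain p where p: "D.awalk u p v" "edge_path_length len p = vdist u v"
    using vdist_attained[OF assms(1)] .
  then obtain a q where pq: "p = a # q" using assms(2) by (cases p) (auto simp: D.awalk_Nil_iff)
  then have a: "a \<in> arcs (darts G)" "src a = u" "D.awalk (tgt a) q v"
    using p by (auto simp: D.awalk_Cons_iff)
  have "vdist u v = len (fst a) + vdist (tgt a) v"
    using vdist_step[OF a(1), of v] vdist_le[OF a(3)] a p pq by fastforce
  then show ?thesis using that a assms(3) by (simp add: first_step_def)
qed

end

locale large_girth = metric_graph G len for G :: "('v, 'e) pre_digraph" and len +
  assumes girth: "ereal (2 * pi) \<le> girth G len"
begin

lemma graph_cycle_length: "graph_cycle G p \<Longrightarrow> 2 * pi \<le> edge_path_length len p"
  using girth INF_lower[of p "{p. graph_cycle G p}" "\<lambda>p. ereal (edge_path_length len p)"]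
  by (fastforce simp: girth_def dest: order_trans)

text \<open>If no source repeats, the walk is a cycle and the girth applies. Otherwise the part
  between two visits to a vertex is a shorter closed walk, and it is again \<open>reduced\<close>, a
  notion that ignores backtracking at the base point.\<close>

lemma closed_reduced_length:
  assumes "D.awalk u p u" "reduced p" "p \<noteq> []"
  shows "2 * pi \<le> edge_path_length len p"
  using assms
proof (induction p arbitrary: u rule: length_induct)
  case (1 p)
  show ?case
  proof (cases "distinct (map (src) p)")
    case True
    have "D.awalk_verts u p = map (src) p @ [u]" "hd (map (src) p) = u"
      using 1(2,4) by (auto simp: D.awalk_verts_conv D.awalk_Cons_iff neq_Nil_conv
          dest: D.awlast_of_awalk[of u p u] split: if_splits)
    then have "distinct (tl (D.awalk_verts u p))"
      using True 1(4) by (cases p) auto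
    then have "graph_cycle G p"
      using 1(2,4) reduced_distinct_edges[OF 1(2,3) True] by (auto simp: graph_cycle_def D.cycle_def)
    then show ?thesis by (rule graph_cycle_length)
  next
    case False
    then obtain xs ys zs x where "map (src) p = xs @ [x] @ ys @ [x] @ zs"
      using not_distinct_decomp by blast
    then obtain p1 a p2 b p3 where p: "p = p1 @ (a # p2) @ (b # p3)"
        and ab: "src a = x" "src b = x"
      by (auto simp: map_eq_append_conv map_eq_Cons_conv append_eq_map_conv Cons_eq_map_conv)
    have "D.awalk x (a # p2) x"
      using 1(2) ab by (auto simp: p D.awalk_Cons_iff)
    moreover have "reduced (a # p2)" using 1(3) unfolding p reduced_append_iff by blast
    moreover have "length (a # p2) < length p" by (simp add: p)
    ultimately have "2 * pi \<le> edge_path_length len (a # p2)" using 1(1) by blast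
    moreover have "0 \<le> edge_path_length len p1" "0 \<le> edge_path_length len (b # p3)"
      by (rule edge_path_length_nonneg; use 1(2) in \<open>auto simp: p D.awalk_def\<close>)+
    ultimately show ?thesis by (simp add: p)
  qed
qed

text \<open>Common first darts are cancelled. Once the walks differ, one reversed followed by the
  other is a closed reduced walk shorter than \<open>2 * pi\<close>.\<close>

lemma reduced_unique:
  assumes "D.awalk u p v" "D.awalk u q v" "reduced p" "reduced q"
    and "edge_path_length len p + edge_path_length len q < 2 * pi"
  shows "p = q"
  using assms
proof (induction p arbitrary: u q)
  case Nil
  then show ?case using closed_reduced_length[of u q] by (auto simp: D.awalk_Nil_iff)
next
  case (Cons a p)
  show ?case
  proof (cases q)
    case Nil
    then show ?thesis using closed_reduced_length[of u "a # p"] Cons.prems by (auto simp: D.awalk_Nil_iff)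
  next
    case (Cons b q')
    show ?thesis
    proof (cases "a = b")
      case True
      have "0 < len (fst a)" using Cons.prems(1) len_pos by (auto simp: D.awalk_Cons_iff)
      then show ?thesis using Cons.IH[of "tgt a" q'] Cons.prems
        by (auto simp: Cons True D.awalk_Cons_iff reduced_Cons_iff)
    next
      case False
      let ?c = "rev_walk (a # p) @ q"
      have "D.awalk v ?c v"
        using awalk_rev_walk[OF Cons.prems(1)] Cons.prems(2) by (rule D.awalk_appendI)
      moreover have "reduced ?c"
        unfolding reduced_append_iff reduced_rev_walk using Cons.prems(3,4) False by (simp add: Cons)
      ultimately have "2 * pi \<le> edge_path_length len ?c"
        by (rule closed_reduced_length) simp
      then show ?thesis using Cons.prems(5) by simp
    qed
  qed
qed

text \<open>Both darts extend to geodesics shorter than \<open>pi\<close>, which coincide by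
  \<open>reduced_unique\<close>.\<close>

lemma first_step_unique:
  assumes "a \<in> arcs (darts G)" "b \<in> arcs (darts G)" "src a = src b"
    and "linked (src a) v" "first_step a v" "first_step b v"
  shows "a = b"
proof -
  have *: "\<exists>p. D.awalk (src c) (c # p) v \<and> reduced (c # p) \<and>
      edge_path_length len (c # p) = vdist (src c) v"
    if "c \<in> arcs (darts G)" "first_step c v" "linked (src c) v" for c
  proof -
    have "linked (tgt c) v"
      using linked_trans[OF linked_sym[OF linked_dart[OF that(1)]] that(3)] .
    then obtain p where p: "D.awalk (tgt c) p v"
      "edge_path_length len p = vdist (tgt c) v" by (rule vdist_attained)
    then have "D.awalk (src c) (c # p) v"
      "edge_path_length len (c # p) = vdist (src c) v"
      using that by (auto simp: D.awalk_Cons_iff first_step_def)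
    then show ?thesis using shortest_reduced by blast
  qed
  obtain p where p: "D.awalk (src a) (a # p) v" "reduced (a # p)"
      "edge_path_length len (a # p) = vdist (src a) v"
    using *[of a] assms by blast
  obtain q where q: "D.awalk (src a) (b # q) v" "reduced (b # q)"
      "edge_path_length len (b # q) = vdist (src a) v"
    using *[of b] assms by fastforce
  have "vdist (src a) v < pi" using assms(5) by (simp add: first_step_def)
  then have "edge_path_length len (a # p) + edge_path_length len (b # q) < 2 * pi"
    using p(3) q(3) by linarith
  from reduced_unique[OF p(1) q(1) p(2) q(2) this] show ?thesis by simp
qed

text \<open>The strict inequalities say that no geodesic to \<open>v\<close> from an end of
  \<open>a\<close> runs along \<open>a\<close>. So a geodesic from \<open>src a\<close>, and
  \<open>a\<close> followed by one from \<open>tgt a\<close>, are different reduced walks with the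
  same ends.\<close>

lemma two_routes_length:
  assumes a: "a \<in> arcs (darts G)" "linked (src a) v"
    and "vdist (src a) v < len (fst a) + vdist (tgt a) v"
    and "vdist (tgt a) v < len (fst a) + vdist (src a) v"
  shows "2 * pi \<le> vdist (src a) v + vdist (tgt a) v + len (fst a)"
proof -
  have lk: "linked (tgt a) v"
    using linked_trans[OF linked_sym[OF linked_dart[OF a(1)]] a(2)] .
  obtain p where p: "D.awalk (src a) p v"
      "edge_path_length len p = vdist (src a) v"
    using vdist_attained[OF a(2)] .
  obtain q where q: "D.awalk (tgt a) q v"
      "edge_path_length len q = vdist (tgt a) v"
    using vdist_attained[OF lk] .
  have "D.awalk (src a) (a # q) v" using a q by (simp add: D.awalk_Cons_iff)
  moreover have "reduced (a # q)"
  proof -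
    have False if "q \<noteq> []" "hd q = rev_dart a"
    proof -
      from \<open>q \<noteq> []\<close> \<open>hd q = rev_dart a\<close> obtain q' where q': "q = rev_dart a # q'"
        by (cases q) auto
      then have "D.awalk (src a) q' v" using q(1) by (simp add: D.awalk_Cons_iff)
      from vdist_le[OF this] q(2) q' assms(4) show False by simp
    qed
    then show ?thesis using shortest_reduced[OF q] by (auto simp: reduced_Cons_iff)
  qed
  moreover have "p \<noteq> a # q" using p(2) q(2) assms(3) by auto
  ultimately have "\<not> edge_path_length len p + edge_path_length len (a # q) < 2 * pi"
    using reduced_unique[OF p(1) _ shortest_reduced[OF p]] by blast
  then show ?thesis using p(2) q(2) by simp
qed

end

section \<open>Subgraphs of diameter at most \<open>\<pi>\<close>\<close>

locale pi_additive =
  fixes \<Phi> :: "real \<Rightarrow> real"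
  assumes \<Phi>_add: "\<Phi> (a + b) = \<Phi> a + \<Phi> b" and \<Phi>_pi: "\<Phi> pi = pi"
begin

lemma \<Phi>_zero: "\<Phi> 0 = 0"
  using \<Phi>_add[of 0 0] by simp

lemma \<Phi>_diff: "\<Phi> (a - b) = \<Phi> a - \<Phi> b"
  using \<Phi>_add[of "a - b" b] by simp

lemma \<Phi>_sum: "\<Phi> (sum f A) = (\<Sum>i\<in>A. \<Phi> (f i))"
  by (induction A rule: infinite_finite_induct) (simp_all add: \<Phi>_zero \<Phi>_add)

end

text \<open>Incommensurability is linear independence of \<open>x\<close> and \<open>pi\<close> over
  Q, so the values at both may be prescribed. The value \<open>pi\<close> at \<open>x\<close> is the
  one that will contradict the inequality for the total length.\<close>

lemma additive_map_separating_pi: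
  assumes "\<not> commensurable_pi x"
  obtains \<Phi> where "pi_additive \<Phi>" "\<Phi> x = pi"
proof -
  interpret Q: vector_space "\<lambda>q x. real_of_rat q * x"
    by unfold_locales (auto simp: algebra_simps of_rat_add of_rat_mult)
  interpret QQ: vector_space_pair "\<lambda>q x. real_of_rat q * x" "\<lambda>q x. real_of_rat q * x" ..
  have "x \<notin> Q.span {pi}"
    using assms by (auto simp: Q.span_singleton commensurable_pi_def)
  moreover have "x \<noteq> pi" using assms unfolding commensurable_pi_def by force
  ultimately have "Q.independent {x, pi}" by (simp add: Q.independent_insert)
  from QQ.linear_independent_extend[OF this, of "\<lambda>_. pi"] obtain \<Phi>
    where \<Phi>: "Vector_Spaces.linear (\<lambda>q x. real_of_rat q * x) (\<lambda>q x. real_of_rat q * x) \<Phi>"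
      "\<Phi> x = pi" "\<Phi> pi = pi" by auto
  interpret Vector_Spaces.linear "\<lambda>q x. real_of_rat q * x" "\<lambda>q x. real_of_rat q * x" \<Phi>
    by (rule \<Phi>(1))
  show ?thesis using that[of \<Phi>] add \<Phi>(2,3) by (simp add: pi_additive_def)
qed

section \<open>Edge sets whose points are pairwise at distance at most \<open>pi\<close>\<close>

context metric_graph
begin

text \<open>The parameter is measured from the source of the dart, whichever way the edge is
  oriented.\<close>

definition dart_point :: "'e \<times> bool \<Rightarrow> real \<Rightarrow> ('v, 'e) graph_point" where
  "dart_point a t = Inner (fst a) (if snd a then t else len (fst a) - t)"

lemma exits_dart_point: "exits (dart_point a t) = {(src a, t), (tgt a, len (fst a) - t)}"
  by (cases a) (auto simp: dart_point_def)

end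

text \<open>A finite subgraph is given by its edges alone, its vertices being their ends, so that
  cycles and complements of segments are treated alike. Distances are still taken in all of
  \<open>G\<close>. Degrees are counted in darts, a loop giving two.\<close>

locale pi_diameter = large_girth G len for G :: "('v, 'e) pre_digraph" and len +
  fixes F :: "'e set"
  assumes F_arcs: "F \<subseteq> arcs G"
    and finite_F: "finite F"
    and two_le_star: "a \<in> F \<times> UNIV \<Longrightarrow>
      2 \<le> card {b \<in> F \<times> UNIV. src b = src a}"
    and diameter: "\<lbrakk>X \<in> Vertex ` src ` (F \<times> UNIV) \<union> {Inner e t |e t. e \<in> F \<and> 0 < t \<and> t < len e};
      Y \<in> Vertex ` src ` (F \<times> UNIV) \<union> {Inner e t |e t. e \<in> F \<and> 0 < t \<and> t < len e}\<rbrakk>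
      \<Longrightarrow> path_dist G len X Y \<le> ereal pi"
begin

abbreviation F_darts :: "('e \<times> bool) set" where "F_darts \<equiv> F \<times> UNIV"

abbreviation F_verts :: "'v set" where "F_verts \<equiv> src ` F_darts"

definition star :: "'v \<Rightarrow> ('e \<times> bool) set" where
  "star y = {b \<in> F_darts. src b = y}"

lemma F_dart_arc: "a \<in> F_darts \<Longrightarrow> a \<in> arcs (darts G)"
  using F_arcs by auto

lemma F_dart_len_pos: "a \<in> F_darts \<Longrightarrow> 0 < len (fst a)"
  using F_arcs len_pos by auto

lemma F_dart_verts:
  assumes "a \<in> F_darts" shows "src a \<in> F_verts" "tgt a \<in> F_verts"
proof -
  show "src a \<in> F_verts" using assms by (rule imageI)
  have "src (rev_dart a) \<in> F_verts" using assms by (intro imageI) simp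
  then show "tgt a \<in> F_verts" by simp
qed

lemma F_vert_verts: "x \<in> F_verts \<Longrightarrow> x \<in> verts G"
  using F_arcs by (auto split: if_splits)

lemma finite_F_darts [simp]: "finite F_darts"
  using finite_F by (simp add: finite_cartesian_product)

lemma finite_star [simp]: "finite (star y)"
  by (simp add: star_def)

lemma dart_point_mem:
  assumes "a \<in> F_darts" "0 < t" "t < len (fst a)"
  shows "dart_point a t \<in> {Inner e t |e t. e \<in> F \<and> 0 < t \<and> t < len e}"
  using assms by (cases a) (auto simp: dart_point_def)

lemma F_verts_linked:
  assumes "x \<in> F_verts" "y \<in> F_verts"
  shows "linked x y" "vdist x y \<le> pi"
proof -
  have "path_dist G len (Vertex x) (Vertex y) \<le> ereal pi"
    by (rule diameter) (use assms in blast)+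
  from path_dist_route[OF this] show "linked x y" "vdist x y \<le> pi"
    by (auto simp: route_lengths_def)
qed

lemma dart_vertex_route:
  assumes "a \<in> F_darts" "y \<in> F_verts" "0 < t" "t < len (fst a)"
  shows "t + vdist (src a) y \<le> pi \<or> len (fst a) - t + vdist (tgt a) y \<le> pi"
proof -
  have "path_dist G len (dart_point a t) (Vertex y) \<le> ereal pi"
    by (rule diameter) (use dart_point_mem assms in blast)+
  from path_dist_route[OF this] show ?thesis
    by (auto simp: route_lengths_def exits_dart_point)
qed

lemma dart_dart_route:
  assumes "a \<in> F_darts" "b \<in> F_darts" "fst a \<noteq> fst b"
    and "0 < t" "t < len (fst a)" "0 < s" "s < len (fst b)"
  shows "t + vdist (src a) (src b) + s \<le> pi \<or>
    t + vdist (src a) (tgt b) + (len (fst b) - s) \<le> pi \<or>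
    len (fst a) - t + vdist (tgt a) (src b) + s \<le> pi \<or>
    len (fst a) - t + vdist (tgt a) (tgt b) + (len (fst b) - s) \<le> pi"
proof -
  have "path_dist G len (dart_point a t) (dart_point b s) \<le> ereal pi"
    by (rule diameter) (use dart_point_mem assms in blast)+
  moreover have "\<nexists>e t' s'. dart_point a t = Inner e t' \<and> dart_point b s = Inner e s'"
    using assms(3) by (auto simp: dart_point_def)
  ultimately have "\<exists>m \<in> route_lengths (dart_point a t) (dart_point b s). m \<le> pi"
    by (rule path_dist_route)
  then show ?thesis
    unfolding route_lengths_def exits_dart_point by auto
qed

section \<open>Defects (the function r of the overview) and edge lengths\<close>

definition defect :: "'v \<Rightarrow> 'v \<Rightarrow> real" where
  "defect x y = pi - vdist x y"

lemma defect_commute: "defect x y = defect y x"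
  by (simp add: defect_def vdist_commute)

lemma defect_self: "x \<in> F_verts \<Longrightarrow> defect x x = pi"
  using F_vert_verts vdist_self by (simp add: defect_def)

lemma first_step_not_rev:
  "a \<in> F_darts \<Longrightarrow> first_step a y \<Longrightarrow> \<not> first_step (rev_dart a) y"
  using F_dart_len_pos[of a] by (auto simp: first_step_def)

lemma first_step_defect:
  "first_step a y \<Longrightarrow> len (fst a) = defect (tgt a) y - defect (src a) y"
  by (simp add: first_step_def defect_def)

text \<open>The claim is that \<open>a\<close> and the two distances add up to
  \<open>2 * pi\<close>. The girth gives one inequality, the diameter bound for a suitable point of
  \<open>a\<close> the other.\<close>

lemma no_first_step_defect:
  assumes a: "a \<in> F_darts" "y \<in> F_verts"
    and no: "\<not> first_step a y" "\<not> first_step (rev_dart a) y"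
  shows "len (fst a) = defect (src a) y + defect (tgt a) y"
proof -
  define l d d' where "l = len (fst a)" "d = vdist (src a) y" "d' = vdist (tgt a) y"
  note defs = this
  note V = F_dart_verts[OF a(1)]
  note lk = F_verts_linked(1)[OF V(1) a(2)] F_verts_linked(1)[OF V(2) a(2)]
  have ub: "d \<le> pi" "d' \<le> pi" using F_verts_linked(2) V a(2) by (auto simp: defs)
  have pos: "0 < l" using F_dart_len_pos a(1) by (simp add: defs)
  have tri: "d \<le> l + d'" "d' \<le> l + d"
    using vdist_step[OF F_dart_arc[OF a(1)] lk(2)]
      vdist_step[of "rev_dart a" y] F_dart_arc[of "rev_dart a"] a(1) lk(1) by (auto simp: defs)
  have "d + d' + l = 2 * pi"
  proof (cases "d = l + d' \<or> d' = l + d")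
    case True
    \<comment> \<open>A geodesic does run along \<open>a\<close>, yet \<open>first_step\<close>
      fails, so the larger distance is exactly \<open>pi\<close>.\<close>
    then have "d = pi \<or> d' = pi" "d = l + d' \<and> d = pi \<or> d' = l + d \<and> d' = pi"
      using no ub by (auto simp: first_step_def defs)
    then show ?thesis by auto
  next
    case False
    then have less: "d < l + d'" "d' < l + d" using tri by auto
    \<comment> \<open>At this \<open>t\<close> the routes to \<open>y\<close> through the two ends
      of \<open>a\<close> both have length \<open>(d + d' + l) / 2\<close>.\<close>
    define t where "t = (l + d' - d) / 2"
    have "t + d \<le> pi \<or> l - t + d' \<le> pi"
      using dart_vertex_route[OF a, of t] less by (simp add: t_def defs)
    then have "d + d' + l \<le> 2 * pi" by (auto simp: t_def field_simps)
    moreover have "2 * pi \<le> d + d' + l"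
      using two_routes_length[OF F_dart_arc[OF a(1)] lk(1)] less by (simp add: defs)
    ultimately show ?thesis by simp
  qed
  then show ?thesis by (simp add: defs defect_def)
qed

text \<open>A geodesic from \<open>y\<close> to \<open>tgt a\<close> extended by \<open>a\<close>
  reversed is a geodesic from \<open>y\<close> to \<open>src a\<close>, with the same first dart.
  The converse direction follows from uniqueness of first steps.\<close>

lemma first_step_target:
  assumes a: "a \<in> F_darts" "y \<in> F_verts" "first_step a y" "tgt a \<noteq> y"
    and b: "b \<in> F_darts" "src b = y"
  shows "first_step b (src a) \<longleftrightarrow> first_step b (tgt a)"
proof -
  note V = F_dart_verts[OF a(1)] F_dart_verts[OF b(1)]
  have eq: "vdist y (src a) = len (fst a) + vdist y (tgt a)" "vdist y (src a) < pi"
    using a(3) by (auto simp: first_step_def vdist_commute[of y])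
  have imp: "first_step c (src a)"
    if c: "c \<in> arcs (darts G)" "src c = y" "first_step c (tgt a)" for c
  proof -
    have lkc: "linked (tgt c) (src a)" "linked (tgt c) (tgt a)"
      using linked_trans[OF linked_sym[OF linked_dart[OF c(1)]]] F_verts_linked(1)[OF a(2)] V c(2)
      by auto
    have "vdist (tgt c) (src a) \<le> vdist (tgt c) (tgt a) + len (fst a)"
      using vdist_step[OF F_dart_arc[OF a(1)], of "tgt c"] linked_sym[OF lkc(2)]
      by (simp add: vdist_commute[of "tgt c"] add.commute)
    moreover have "vdist y (src a) \<le> len (fst c) + vdist (tgt c) (src a)"
      using vdist_step[OF c(1), of "src a"] lkc(1) c(2) by simp
    ultimately show ?thesis using c eq by (auto simp: first_step_def)
  qed
  show ?thesis
  proof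
    assume fs: "first_step b (src a)"
    have "vdist y (tgt a) < pi" using eq F_dart_len_pos[OF a(1)] by simp
    then obtain c where c: "c \<in> arcs (darts G)" "src c = y" "first_step c (tgt a)"
      using first_step_exists[OF F_verts_linked(1)[OF a(2) V(2)]] a(4) by metis
    have "c = b"
      using first_step_unique[OF c(1) F_dart_arc[OF b(1)] _ _ imp[OF c] fs]
        c(2) b(2) F_verts_linked(1)[OF a(2) V(1)] by simp
    then show "first_step b (tgt a)" using c by simp
  next
    assume "first_step b (tgt a)"
    then show "first_step b (src a)" using imp F_dart_arc b by blast
  qed
qed

text \<open>The point of \<open>a\<close> antipodal to \<open>y\<close> must remain within distance \<open>\<pi>\<close> when \<open>y\<close> is moved
  slightly along \<open>b\<close>, so some geodesic from it to \<open>y\<close> arrives along \<open>b\<close>.\<close>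

lemma no_first_step_star:
  assumes a: "a \<in> F_darts" "y \<in> F_verts" "\<not> first_step a y" "\<not> first_step (rev_dart a) y"
    and lt: "vdist (src a) y < pi" "vdist (tgt a) y < pi"
    and b: "b \<in> F_darts" "src b = y" "fst a \<noteq> fst b"
  shows "first_step b (src a) \<or> first_step b (tgt a)"
proof (rule ccontr)
  assume no: "\<not> ?thesis"
  note V = F_dart_verts[OF a(1)] F_dart_verts[OF b(1)]
  define d d' l where "d = vdist (src a) y" "d' = vdist (tgt a) y" "l = len (fst b)"
  note defs = this
  define g g' where "g = l + vdist (tgt b) (src a) - d" "g' = l + vdist (tgt b) (tgt a) - d'"
  note gs = this
  have la: "len (fst a) = 2 * pi - d - d'"
    using no_first_step_defect[OF a] by (simp add: defect_def defs)
  have "0 \<le> g" "0 \<le> g'"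
    using vdist_step[OF F_dart_arc[OF b(1)]] F_verts_linked(1)[OF V(4)] V b(2)
    by (auto simp: gs defs vdist_commute[of _ y])
  moreover have "g \<noteq> 0" "g' \<noteq> 0"
    using no lt b(2) by (auto simp: first_step_def gs defs vdist_commute[of _ y])
  ultimately have g: "0 < g" "0 < g'" by auto
  have l: "0 < l" using F_dart_len_pos[OF b(1)] by (simp add: defs)
  define s where "s = min l (min g g') / 2"
  have s: "0 < s" "s < l" "s < g" "s < g'" using g l by (auto simp: s_def)
  \<comment> \<open>The point of \<open>a\<close> at \<open>pi - d\<close> from its source is
    antipodal to \<open>y\<close>. The four routes from it to the point at \<open>s\<close> on
    \<open>b\<close> exceed \<open>pi\<close> by \<open>s\<close>, \<open>s\<close>,
    \<open>g - s\<close> and \<open>g' - s\<close>.\<close>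
  have "0 < pi - d" "pi - d < len (fst a)" using lt la by (auto simp: defs)
  from dart_dart_route[OF a(1) b(1,3) this s(1)] s b(2) show False
    by (auto simp: la gs defs vdist_commute[of _ "tgt b"])
qed

text \<open>Read backwards, these are the directions from which geodesics from \<open>x\<close>
  reach \<open>y\<close>. The set may be empty, for instance if the geodesic arrives along an edge
  outside \<open>F\<close>.\<close>

definition incoming :: "'v \<Rightarrow> 'v \<Rightarrow> ('e \<times> bool) set" where
  "incoming y x = {b \<in> star y. first_step b x}"

lemma incoming_subset: "incoming y x \<subseteq> star y"
  by (auto simp: incoming_def)

lemma incoming_self: "y \<in> F_verts \<Longrightarrow> incoming y y = {}"
proof -
  assume y: "y \<in> F_verts"
  have "\<not> first_step b y" if "b \<in> F_darts" "src b = y" for b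
    using vdist_self[OF F_vert_verts[OF y]] F_dart_len_pos[OF that(1)] that(2)
      vdist_nonneg[OF F_verts_linked(1)[OF F_dart_verts(2)[OF that(1)] y]]
    by (auto simp: first_step_def)
  then show ?thesis by (auto simp: incoming_def star_def)
qed

lemma card_incoming:
  assumes "y \<in> F_verts" "x \<in> F_verts" shows "card (incoming y x) \<le> 1"
proof -
  have "b = c" if "b \<in> incoming y x" "c \<in> incoming y x" for b c
    using first_step_unique[of b c x] that F_dart_arc F_verts_linked(1)[OF assms]
    by (auto simp: incoming_def star_def)
  then show ?thesis
    using card_le_Suc0_iff_eq[OF finite_subset[OF incoming_subset finite_star], of y x] by auto
qed

lemma card_star: "y \<in> F_verts \<Longrightarrow> 2 \<le> card (star y)"
  using two_le_star by (auto simp: star_def)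

text \<open>The darts at \<open>y\<close> are covered by two sets with at most one element each, and
  there are at least two of them, so equality holds throughout.\<close>

lemma no_first_step_card:
  assumes a: "a \<in> F_darts" "y \<in> F_verts" "\<not> first_step a y" "\<not> first_step (rev_dart a) y"
    and lt: "vdist (src a) y < pi" "vdist (tgt a) y < pi"
  shows "card (star y) = 2"
    and "card (incoming y (src a)) = (if src a = y then 0 else 1)"
    and "card (incoming y (tgt a)) = (if tgt a = y then 0 else 1)"
proof -
  note V = F_dart_verts[OF a(1)]
  \<comment> \<open>If \<open>a\<close> starts at \<open>y\<close>, then \<open>incoming y y\<close>
    is empty and \<open>a\<close> itself fills the place; likewise \<open>rev_dart a\<close> in
    \<open>B\<close>.\<close>
  define A where "A = (if src a = y then {a} else incoming y (src a))"
  define B where "B = (if tgt a = y then {rev_dart a} else incoming y (tgt a))"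
  have "star y \<subseteq> A \<union> B"
  proof
    fix b assume b: "b \<in> star y"
    show "b \<in> A \<union> B"
    proof (cases "fst a = fst b")
      case True
      then have "b = a \<or> b = rev_dart a" using fst_dart_eq_iff[of b a] by auto
      then show ?thesis using b by (auto simp: A_def B_def star_def)
    next
      case False
      then have "b \<in> incoming y (src a) \<union> incoming y (tgt a)"
        using no_first_step_star[OF a lt, of b] b by (auto simp: incoming_def star_def)
      then show ?thesis using incoming_self[OF a(2)] by (auto simp: A_def B_def)
    qed
  qed
  moreover have fin: "finite (incoming y x)" for x
    by (rule finite_subset[OF incoming_subset finite_star])
  then have "finite A" "finite B" by (auto simp: A_def B_def)
  ultimately have "card (star y) \<le> card A + card B"
    by (meson card_Un_le card_mono finite_UnI order_trans)
  moreover have "card A \<le> 1" "card B \<le> 1"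
    using card_incoming a(2) V by (auto simp: A_def B_def)
  ultimately have AB: "card (star y) = 2" "card A = 1" "card B = 1"
    using card_star[OF a(2)] by linarith+
  then show "card (star y) = 2"
    and "card (incoming y (src a)) = (if src a = y then 0 else 1)"
    and "card (incoming y (tgt a)) = (if tgt a = y then 0 else 1)"
    using incoming_self[OF a(2)] by (auto simp: A_def B_def split: if_splits)
qed

end

section \<open>The total length\<close>

context pi_diameter
begin

text \<open>The coefficient of \<open>defect (src a) y\<close> when the length of \<open>a\<close>
  is expressed by defects with respect to \<open>y\<close>.\<close>

definition step_sign :: "'e \<times> bool \<Rightarrow> 'v \<Rightarrow> real" where
  "step_sign a y = (if first_step a y then - 1 else 1)"

definition star_sum :: "'v \<Rightarrow> 'v \<Rightarrow> real" where
  "star_sum y x = (\<Sum>b\<in>star y. step_sign b x)"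

lemma star_sum_eq: "star_sum y x = real (card (star y)) - 2 * real (card (incoming y x))"
proof -
  have "star_sum y x = (\<Sum>b\<in>star y. 1 - 2 * of_bool (first_step b x))"
    unfolding star_sum_def step_sign_def by (rule sum.cong) auto
  also have "\<dots> = real (card (star y)) - 2 * (\<Sum>b\<in>star y. of_bool (first_step b x))"
    by (simp add: sum_subtractf sum_distrib_left)
  also have "(\<Sum>b\<in>star y. of_bool (first_step b x)) = real (card (incoming y x))"
    by (simp add: incoming_def sum.If_cases of_bool_def Int_def)
  finally show ?thesis .
qed

text \<open>At least two darts start at \<open>y\<close> and at most one geodesic direction is
  subtracted twice. This is what makes the coefficients of the squares nonnegative.\<close>

lemma star_sum_nonneg: "y \<in> F_verts \<Longrightarrow> x \<in> F_verts \<Longrightarrow> 0 \<le> star_sum y x"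
  using card_star[of y] card_incoming[of y x] by (simp add: star_sum_eq)

lemma star_sum_self: "y \<in> F_verts \<Longrightarrow> star_sum y y = real (card (star y))"
  by (simp add: star_sum_eq incoming_self)

lemma sum_F_darts_by_src: "(\<Sum>b\<in>F_darts. g b) = (\<Sum>y\<in>F_verts. \<Sum>b\<in>star y. g b)"
  using sum.image_gen[OF finite_F_darts, of g src] by (simp add: star_def)

lemma sum_F_darts_rev: "(\<Sum>b\<in>F_darts. g (rev_dart b)) = (\<Sum>b\<in>F_darts. g b)"
  by (rule sum.reindex_bij_witness[of _ rev_dart rev_dart]) auto

end

section \<open>The quadratic inequality for the total length\<close>

locale pi_diameter_additive = pi_diameter G len F + pi_additive \<Phi>
  for G :: "('v, 'e) pre_digraph" and len and F and \<Phi>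
begin

abbreviation \<rho> :: "'v \<Rightarrow> 'v \<Rightarrow> real" where "\<rho> x y \<equiv> \<Phi> (defect x y)"

text \<open>The three linear relations between a length and two defects, unified by signs and
  carried over by \<open>\<Phi>\<close>.\<close>

lemma \<Phi>_len:
  assumes "a \<in> F_darts" "y \<in> F_verts"
  shows "\<Phi> (len (fst a)) =
    step_sign a y * \<rho> (src a) y + step_sign (rev_dart a) y * \<rho> (tgt a) y"
proof -
  consider "first_step a y" | "first_step (rev_dart a) y"
    | "\<not> first_step a y" "\<not> first_step (rev_dart a) y" by blast
  then show ?thesis
  proof cases
    case 1
    then show ?thesis using first_step_defect[OF 1] first_step_not_rev[OF assms(1) 1]
      by (simp add: step_sign_def \<Phi>_diff)
  next
    case 2
    then have "\<not> first_step a y" using first_step_not_rev[OF assms(1)] by blast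
    then show ?thesis using first_step_defect[OF 2] 2 by (simp add: step_sign_def \<Phi>_diff)
  next
    case 3
    then show ?thesis using no_first_step_defect[OF assms 3] by (simp add: step_sign_def \<Phi>_add)
  qed
qed

text \<open>Away from \<open>y\<close> both ends of \<open>a\<close> have the same incoming darts,
  hence equal star sums, and the opposite signs cancel. If \<open>a\<close> ends at
  \<open>y\<close>, the star sums differ by 2.\<close>

lemma cross_term_first_step:
  assumes a: "a \<in> F_darts" "y \<in> F_verts" "first_step a y"
  shows "\<rho> (src a) y * \<rho> (tgt a) y *
      (star_sum y (src a) * step_sign (rev_dart a) y + star_sum y (tgt a) * step_sign a y) =
    - (2 * pi) * (pi - \<Phi> (len (fst a))) * (of_bool (src a = y) + of_bool (tgt a = y))"
proof -
  note V = F_dart_verts[OF a(1)]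
  have "0 < vdist (src a) y"
    using a(3) F_dart_len_pos[OF a(1)] vdist_nonneg[OF F_verts_linked(1)[OF V(2) a(2)]]
    by (simp add: first_step_def)
  then have src: "src a \<noteq> y" using vdist_self[OF F_vert_verts[OF a(2)]] by auto
  have sgn: "step_sign a y = - 1" "step_sign (rev_dart a) y = 1"
    using a(3) first_step_not_rev[OF a(1,3)] by (simp_all add: step_sign_def)
  show ?thesis
  proof (cases "tgt a = y")
    case False
    have "incoming y (src a) = incoming y (tgt a)"
      using first_step_target[OF a False] unfolding incoming_def star_def by blast
    then show ?thesis using src False by (simp add: sgn star_sum_eq)
  next
    case True
    have y: "y \<in> verts G" using F_vert_verts a(2) by blast
    have "rev_dart a \<in> star y" using a(1) True by (simp add: star_def)
    moreover have "first_step (rev_dart a) (src a)"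
      using a(3) vdist_self[OF F_vert_verts[OF V(1)]] vdist_self[OF y] True
      by (simp add: first_step_def vdist_commute[of y "src a"])
    ultimately have "rev_dart a \<in> incoming y (src a)" by (simp add: incoming_def)
    then have "0 < card (incoming y (src a))"
      using finite_subset[OF incoming_subset finite_star, of y "src a"]
      by (auto simp: card_gt_0_iff)
    then have "card (incoming y (src a)) = 1" using card_incoming[OF a(2) V(1)] by simp
    then have "star_sum y (src a) = star_sum y y - 2"
      using star_sum_self[OF a(2)] by (simp add: star_sum_eq)
    moreover have "\<rho> (tgt a) y = pi" using True defect_self[OF a(2)] \<Phi>_pi by simp
    moreover have "\<rho> (src a) y = pi - \<Phi> (len (fst a))"
      using \<Phi>_len[OF a(1,2)] \<open>\<rho> (tgt a) y = pi\<close> by (simp add: sgn)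
    ultimately show ?thesis using src True by (simp add: sgn)
  qed
qed

text \<open>A first step along \<open>rev_dart a\<close> reduces to the previous lemma. Without
  first steps and with both distances below \<open>pi\<close>, the star of \<open>y\<close> has two
  darts, and the star sum vanishes at each end of \<open>a\<close> other than
  \<open>y\<close>.\<close>

lemma cross_term:
  assumes a: "a \<in> F_darts" "y \<in> F_verts"
  shows "\<rho> (src a) y * \<rho> (tgt a) y *
      (star_sum y (src a) * step_sign (rev_dart a) y + star_sum y (tgt a) * step_sign a y) =
    - (2 * pi) * (pi - \<Phi> (len (fst a))) * (of_bool (src a = y) + of_bool (tgt a = y))"
proof -
  note V = F_dart_verts[OF a(1)]
  consider "first_step a y" | "first_step (rev_dart a) y"
    | "\<not> first_step a y" "\<not> first_step (rev_dart a) y" by blast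
  then show ?thesis
  proof cases
    case 1
    then show ?thesis by (rule cross_term_first_step[OF a])
  next
    case 2
    then have "first_step (rev_dart a) y" "rev_dart a \<in> F_darts" using a by simp_all
    from cross_term_first_step[OF this(2) a(2) this(1)] show ?thesis
      by (simp add: mult.commute[of "\<rho> (tgt a) y"] add.commute)
  next
    case 3
    have sgn: "step_sign a y = 1" "step_sign (rev_dart a) y = 1" using 3 by (simp_all add: step_sign_def)
    have len: "\<Phi> (len (fst a)) = \<rho> (src a) y + \<rho> (tgt a) y"
      using \<Phi>_len[OF a] by (simp add: sgn)
    have self: "\<rho> y y = pi" using defect_self[OF a(2)] \<Phi>_pi by simp
    show ?thesis
    proof (cases "vdist (src a) y < pi \<and> vdist (tgt a) y < pi")
      case True
      then have "star_sum y (src a) = 2 * of_bool (src a = y)" "star_sum y (tgt a) = 2 * of_bool (tgt a = y)"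
        using no_first_step_card[OF a 3] by (simp_all add: star_sum_eq)
      then show ?thesis
        by (cases "src a = y"; cases "tgt a = y") (simp_all add: sgn len self algebra_simps)
    next
      case False
      \<comment> \<open>The left-hand side is zero. If one end of \<open>a\<close> is
        \<open>y\<close>, then \<open>\<Phi>\<close> sends its length to \<open>pi\<close>, and the
        right-hand side is zero too.\<close>
      then have "\<rho> (src a) y = 0 \<or> \<rho> (tgt a) y = 0"
        using F_verts_linked(2)[OF V(1) a(2)] F_verts_linked(2)[OF V(2) a(2)] \<Phi>_zero
        by (auto simp: defect_def not_less)
      then show ?thesis
        by (cases "src a = y"; cases "tgt a = y") (auto simp: sgn len self)
    qed
  qed
qed

text \<open>Reversing darts shows that the two terms of \<open>\<Phi>_len\<close> have the same sum,
  which is then grouped by sources.\<close>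

lemma sum_\<Phi>_len:
  assumes "x \<in> F_verts"
  shows "(\<Sum>b\<in>F_darts. \<Phi> (len (fst b))) = 2 * (\<Sum>y\<in>F_verts. star_sum y x * \<rho> y x)"
proof -
  have "(\<Sum>b\<in>F_darts. \<Phi> (len (fst b))) = (\<Sum>b\<in>F_darts. step_sign b x * \<rho> (src b) x)
      + (\<Sum>b\<in>F_darts. step_sign (rev_dart b) x * \<rho> (src (rev_dart b)) x)"
    using \<Phi>_len[OF _ assms] by (simp flip: sum.distrib)
  also have "\<dots> = 2 * (\<Sum>b\<in>F_darts. step_sign b x * \<rho> (src b) x)"
    using sum_F_darts_rev[of "\<lambda>b. step_sign b x * \<rho> (src b) x"] by simp
  also have "(\<Sum>b\<in>F_darts. step_sign b x * \<rho> (src b) x) = (\<Sum>y\<in>F_verts. star_sum y x * \<rho> y x)"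
    unfolding sum_F_darts_by_src star_sum_def sum_distrib_right
    by (intro sum.cong refl) (simp add: star_def)
  finally show ?thesis .
qed

text \<open>In \<open>A * A\<close> one factor is expanded by \<open>sum_\<Phi>_len\<close> with
  respect to \<open>src a\<close>, the other by \<open>\<Phi>_len\<close> with respect to
  \<open>y\<close>. The squares form \<open>P\<close>, the mixed products \<open>Q\<close>; the
  diagonal part of \<open>P\<close> compensates the negative constant in \<open>Q\<close>.\<close>

theorem total_length_inequality: "2 * pi * \<Phi> (sum len F) \<le> (\<Phi> (sum len F))\<^sup>2"
proof -
  define A where "A = (\<Sum>a\<in>F_darts. \<Phi> (len (fst a)))"
  define n where "n = real (card F_darts)"
  define P where "P = (\<Sum>y\<in>F_verts. \<Sum>a\<in>F_darts. star_sum y (src a) * step_sign a y * (\<rho> (src a) y)\<^sup>2)"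
  define Q where "Q = (\<Sum>y\<in>F_verts. \<Sum>a\<in>F_darts.
    star_sum y (src a) * step_sign (rev_dart a) y * (\<rho> (src a) y * \<rho> (tgt a) y))"
  have fin: "finite F_verts" by simp
  \<comment> \<open>Each edge carries two darts.\<close>
  have "A = (\<Sum>e\<in>F. \<Sum>b\<in>(UNIV :: bool set). \<Phi> (len e))"
    unfolding A_def by (subst sum.cartesian_product) (simp add: case_prod_beta)
  then have A: "A = 2 * \<Phi> (sum len F)" by (simp add: \<Phi>_sum sum_distrib_left)

  have "A * A = (\<Sum>a\<in>F_darts. \<Phi> (len (fst a)) * A)"
    by (simp add: A_def sum_distrib_right)
  also have "\<dots> = (\<Sum>a\<in>F_darts. \<Sum>y\<in>F_verts. 2 * (\<Phi> (len (fst a)) * (star_sum y (src a) * \<rho> y (src a))))"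
  proof (rule sum.cong[OF refl])
    fix a assume a: "a \<in> F_darts"
    have "A = 2 * (\<Sum>y\<in>F_verts. star_sum y (src a) * \<rho> y (src a))"
      unfolding A_def by (rule sum_\<Phi>_len[OF F_dart_verts(1)[OF a]])
    then show "\<Phi> (len (fst a)) * A =
        (\<Sum>y\<in>F_verts. 2 * (\<Phi> (len (fst a)) * (star_sum y (src a) * \<rho> y (src a))))"
      by (simp add: sum_distrib_left algebra_simps)
  qed
  also have "\<dots> = (\<Sum>y\<in>F_verts. \<Sum>a\<in>F_darts. 2 * (\<Phi> (len (fst a)) * (star_sum y (src a) * \<rho> y (src a))))"
    by (rule sum.swap)
  also have "\<dots> = 2 * P + 2 * Q"
    unfolding P_def Q_def sum_distrib_left sum.distrib[symmetric]
  proof (intro sum.cong refl)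
    fix y a assume "y \<in> F_verts" "a \<in> F_darts"
    then have len: "\<Phi> (len (fst a)) =
        step_sign a y * \<rho> (src a) y + step_sign (rev_dart a) y * \<rho> (tgt a) y"
      by (rule \<Phi>_len[rotated])
    show "2 * (\<Phi> (len (fst a)) * (star_sum y (src a) * \<rho> y (src a))) =
        2 * (star_sum y (src a) * step_sign a y * (\<rho> (src a) y)\<^sup>2) +
        2 * (star_sum y (src a) * step_sign (rev_dart a) y * (\<rho> (src a) y * \<rho> (tgt a) y))"
      unfolding len defect_commute[of y] by (simp add: algebra_simps power2_eq_square)
  qed
  finally have AA: "A * A = 2 * P + 2 * Q" .

  \<comment> \<open>reversing the darts turns \<open>Q\<close> into a sum of the cross terms computed above\<close>
  have Q': "Q = (\<Sum>y\<in>F_verts. \<Sum>a\<in>F_darts. star_sum y (tgt a) * step_sign a y * (\<rho> (src a) y * \<rho> (tgt a) y))"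
    unfolding Q_def by (rule sum.cong[OF refl], subst sum_F_darts_rev[symmetric]) (simp add: mult.commute)
  have "2 * Q = (\<Sum>y\<in>F_verts. \<Sum>a\<in>F_darts. \<rho> (src a) y * \<rho> (tgt a) y *
      (star_sum y (src a) * step_sign (rev_dart a) y + star_sum y (tgt a) * step_sign a y))"
    unfolding mult_2 by (subst (2) Q', unfold Q_def sum.distrib[symmetric])
      (intro sum.cong refl, simp add: algebra_simps)
  also have "\<dots> = (\<Sum>y\<in>F_verts. \<Sum>a\<in>F_darts.
      - (2 * pi) * (pi - \<Phi> (len (fst a))) * (of_bool (src a = y) + of_bool (tgt a = y)))"
    using cross_term by (intro sum.cong refl) blast
  also have "\<dots> = (\<Sum>a\<in>F_darts. \<Sum>y\<in>F_verts.
      - (2 * pi) * (pi - \<Phi> (len (fst a))) * (of_bool (src a = y) + of_bool (tgt a = y)))"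
    by (rule sum.swap)
  also have "\<dots> = (\<Sum>a\<in>F_darts. - (4 * pi) * (pi - \<Phi> (len (fst a))))"
  proof (rule sum.cong[OF refl])
    fix a assume "a \<in> F_darts"
    then have "(\<Sum>y\<in>F_verts. of_bool (src a = y) + of_bool (tgt a = y)) = (2 :: real)"
      using F_dart_verts[of a] fin by (simp add: sum.distrib of_bool_def sum.delta)
    then show "(\<Sum>y\<in>F_verts. - (2 * pi) * (pi - \<Phi> (len (fst a))) * (of_bool (src a = y) + of_bool (tgt a = y)))
        = - (4 * pi) * (pi - \<Phi> (len (fst a)))"
      unfolding sum_distrib_left[symmetric] by simp
  qed
  also have "\<dots> = 4 * pi * A - 4 * pi\<^sup>2 * n"
    by (simp add: A_def n_def sum_distrib_left sum_subtractf algebra_simps power2_eq_square)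
  finally have Q: "2 * Q = 4 * pi * A - 4 * pi\<^sup>2 * n" .

  \<comment> \<open>Only the terms of \<open>P\<close> with \<open>x = y\<close> are kept. For a
    star of \<open>k\<close> darts such a term is \<open>k * k * pi * pi\<close>, and
    \<open>k\<close> is at least 2.\<close>
  have "2 * pi\<^sup>2 * n = (\<Sum>y\<in>F_verts. 2 * pi\<^sup>2 * real (card (star y)))"
    using sum_F_darts_by_src[of "\<lambda>_. 1 :: real"] by (simp add: n_def flip: sum_distrib_left)
  also have "\<dots> \<le> (\<Sum>y\<in>F_verts. \<Sum>x\<in>F_verts. star_sum y x * star_sum x y * (\<rho> x y)\<^sup>2)"
  proof (rule sum_mono)
    fix y assume y: "y \<in> F_verts"
    have "2 * pi\<^sup>2 * real (card (star y)) \<le> star_sum y y * star_sum y y * (\<rho> y y)\<^sup>2"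
      using card_star[OF y] by (simp add: star_sum_self[OF y] defect_self[OF y] \<Phi>_pi mult_mono)
    also have "\<dots> \<le> (\<Sum>x\<in>F_verts. star_sum y x * star_sum x y * (\<rho> x y)\<^sup>2)"
      by (rule member_le_sum[OF y _ fin]) (use star_sum_nonneg y in auto)
    finally show "2 * pi\<^sup>2 * real (card (star y)) \<le> (\<Sum>x\<in>F_verts. star_sum y x * star_sum x y * (\<rho> x y)\<^sup>2)" .
  qed
  also have "\<dots> = P"
    unfolding P_def sum_F_darts_by_src
  proof (intro sum.cong refl)
    fix y x
    have "(\<Sum>a\<in>star x. star_sum y (src a) * step_sign a y * (\<rho> (src a) y)\<^sup>2) =
        (\<Sum>a\<in>star x. step_sign a y * (star_sum y x * (\<rho> x y)\<^sup>2))"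
      by (rule sum.cong) (auto simp: star_def)
    then show "star_sum y x * star_sum x y * (\<rho> x y)\<^sup>2 =
        (\<Sum>a\<in>star x. star_sum y (src a) * step_sign a y * (\<rho> (src a) y)\<^sup>2)"
      by (simp add: star_sum_def[of x] flip: sum_distrib_right)
  qed
  finally have "4 * pi * A \<le> A * A" using AA Q by (simp add: algebra_simps)
  then show ?thesis by (simp add: A power2_eq_square)
qed

end

context pi_diameter
begin

text \<open>With \<open>\<Phi>\<close> sending the total length to \<open>pi\<close>, the inequality
  would bound twice the square of \<open>pi\<close> by that square.\<close>

theorem total_length_commensurable: "commensurable_pi (sum len F)"
proof (rule ccontr)
  assume "\<not> commensurable_pi (sum len F)"
  then obtain \<Phi> where \<Phi>: "pi_additive \<Phi>" "\<Phi> (sum len F) = pi"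
    by (rule additive_map_separating_pi)
  interpret pi_additive \<Phi> by (rule \<Phi>(1))
  interpret pi_diameter_additive G len F \<Phi> by unfold_locales
  from total_length_inequality show False by (simp add: \<Phi>(2) power2_eq_square)
qed

end

section \<open>Cycles and segments\<close>

lemma graph_degree_darts:
  assumes "finite (arcs G)"
  shows "graph_degree G v = card {b \<in> arcs (darts G). tail (darts G) b = v}"
proof -
  have "{b \<in> arcs (darts G). tail (darts G) b = v} =
      (\<lambda>e. (e, False)) ` in_arcs G v \<union> (\<lambda>e. (e, True)) ` out_arcs G v"
    by (auto simp: in_arcs_def out_arcs_def split: if_splits)
  moreover have "finite (in_arcs G v)" "finite (out_arcs G v)"
    using assms by (auto simp: in_arcs_def out_arcs_def)
  ultimately have "card {b \<in> arcs (darts G). tail (darts G) b = v} =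
      card ((\<lambda>e. (e, False)) ` in_arcs G v) + card ((\<lambda>e. (e, True)) ` out_arcs G v)"
    by (simp only:, intro card_Un_disjoint) auto
  then show ?thesis
    by (simp add: graph_degree_def in_degree_def out_degree_def card_image inj_on_def)
qed

lemma card_ge_2I: "finite A \<Longrightarrow> x \<in> A \<Longrightarrow> y \<in> A \<Longrightarrow> x \<noteq> y \<Longrightarrow> 2 \<le> card A"
  using card_mono[of A "{x, y}"] by simp

context metric_graph
begin

lemma awalk_next:
  assumes "D.awalk u p v" "d \<in> set p" "tgt d \<noteq> v"
  shows "tgt d \<in> src ` set p"
  using assms
proof (induction p arbitrary: u)
  case (Cons a p)
  show ?case
  proof (cases "d \<in> set p")
    case True
    then show ?thesis using Cons by (auto simp: D.awalk_Cons_iff)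
  next
    case False
    then have "d = a" using Cons.prems(2) by simp
    then show ?thesis using Cons.prems by (cases p) (auto simp: D.awalk_Cons_iff D.awalk_Nil_iff)
  qed
qed simp

lemma awalk_prev:
  assumes "D.awalk u p v" "d \<in> set p" "src d \<noteq> u"
  shows "src d \<in> tgt ` set p"
proof -
  have "rev_dart d \<in> set (rev_walk p)" using assms(2) by (simp add: rev_walk_def)
  from awalk_next[OF awalk_rev_walk[OF assms(1)] this] assms(3)
  have "src d \<in> src ` rev_dart ` set p" by (simp add: rev_walk_def)
  then show ?thesis by (simp add: image_image)
qed

text \<open>A cycle enters and leaves each of its vertices. The leaving dart is not the reverse of
  the entering one, since edges do not repeat; for a loop the two directions give two darts.\<close>

lemma graph_cycle_star:
  assumes p: "graph_cycle G p" and a: "a \<in> (fst ` set p) \<times> UNIV"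
  shows "2 \<le> card {b \<in> (fst ` set p) \<times> UNIV. src b = src a}"
proof -
  obtain u where u: "D.awalk u p u" "p \<noteq> []" and edges: "distinct (map fst p)"
    using p by (auto simp: graph_cycle_def D.cycle_def)
  have hd: "hd p \<in> set p" "src (hd p) = u" using u by (auto simp: neq_Nil_conv D.awalk_Cons_iff)
  have last: "last p \<in> set p" "tgt (last p) = u"
  proof -
    have "D.awlast u p = u" using u(1) by blast
    then show "tgt (last p) = u" using u(2) by (simp add: D.awalk_verts_conv)
  qed (use u(2) in simp)
  have "fst a \<in> fst ` set p" using a by (simp add: mem_Times_iff)
  then obtain d where "d \<in> set p" "fst a = fst d" by (rule imageE)
  then have d: "d \<in> set p" "a = d \<or> a = rev_dart d" by (simp_all add: fst_dart_eq_iff)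
  have "u \<in> src ` set p" "u \<in> tgt ` set p"
    using imageI[OF hd(1), of src] imageI[OF last(1), of tgt] hd(2) last(2) by simp_all
  then have ends: "tgt d \<in> src ` set p" "src d \<in> tgt ` set p"
    using awalk_next[OF u(1) d(1)] awalk_prev[OF u(1) d(1)]
    by (metis, metis)
  have "src a \<in> src ` set p \<and> src a \<in> tgt ` set p"
    using d(2) ends imageI[OF d(1), of src] imageI[OF d(1), of tgt] by (elim disjE) simp_all
  then obtain b c where "b \<in> set p" "src a = src b" "c \<in> set p" "src a = tgt c"
    by (elim conjE imageE)
  then have bc: "b \<in> set p" "src b = src a" "c \<in> set p" "tgt c = src a" by simp_all
  have "b \<noteq> rev_dart c"
  proof
    assume *: "b = rev_dart c"
    then have "fst b = fst c" by simp
    then have "b = c" using edges bc(1,3) unfolding distinct_map by (blast dest: inj_onD)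
    with * show False by simp
  qed
  moreover have "finite {b \<in> (fst ` set p) \<times> UNIV. src b = src a}"
    by (rule finite_subset[of _ "(fst ` set p) \<times> UNIV"]) auto
  ultimately show ?thesis
    using bc by (intro card_ge_2I[of _ b "rev_dart c"]) (simp_all add: mem_Times_iff)
qed

lemma apath_reduced: "D.apath u p v \<Longrightarrow> reduced p"
proof (induction p arbitrary: u)
  case (Cons a p)
  have "p = [] \<or> hd p \<noteq> rev_dart a"
  proof (cases p)
    case (Cons b q)
    then have "src a \<notin> set (D.awalk_verts (tgt a) (b # q))" "D.apath (tgt b) q v"
      using Cons.prems by (auto simp: D.apath_Cons_iff)
    with D.hd_in_awalk_verts(2) have "tgt b \<noteq> src a" by fastforce
    then show ?thesis by (auto simp: Cons)
  qed simp
  then show ?case using Cons by (auto simp: D.apath_Cons_iff reduced_Cons_iff)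
qed simp

lemma apath_distinct:
  assumes "D.apath u p v"
  shows "distinct (map src p)" "distinct (map tgt p)" "u \<notin> tgt ` set p" "v \<notin> src ` set p"
    "distinct (map fst p)"
proof -
  have p: "D.awalk u p v" "distinct (D.awalk_verts u p)" using assms by (auto simp: D.apath_def)
  then have "D.cas u p v" by blast
  have "distinct (map src p) \<and> v \<notin> src ` set p"
    using p D.awalk_verts_conv[of u p] D.awlast_of_awalk[OF p(1)]
    by (cases "p = []") (auto simp: NOMATCH_def)
  moreover have "distinct (map tgt p) \<and> u \<notin> tgt ` set p"
    using p D.awalk_verts_conv'[OF \<open>D.cas u p v\<close>]
    by (cases p) (auto simp: D.awalk_Cons_iff)
  ultimately show "distinct (map src p)" "distinct (map tgt p)" "u \<notin> tgt ` set p" "v \<notin> src ` set p"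
    by auto
  then show "distinct (map fst p)"
    using reduced_distinct_edges[OF p(1) apath_reduced[OF assms]] by blast
qed

text \<open>Removing a segment leaves no edge at its inner vertices, takes one of at least three
  darts at its ends, and changes nothing elsewhere.\<close>

lemma graph_segment_complement_star:
  assumes fin: "finite (arcs G)" and deg: "\<forall>w \<in> verts G. 2 \<le> graph_degree G w"
    and p: "graph_segment G p" and a: "a \<in> (arcs G - fst ` set p) \<times> UNIV"
  shows "2 \<le> card {b \<in> (arcs G - fst ` set p) \<times> UNIV. src b = src a}"
proof -
  define w where "w = src a"
  define S where "S = {b \<in> arcs (darts G). src b = w}"
  define B where "B = {b \<in> (fst ` set p) \<times> UNIV. src b = w}"
  obtain u v where uv: "D.apath u p v" "3 \<le> graph_degree G u" "3 \<le> graph_degree G v"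
    and inner: "\<forall>w \<in> set (D.inner_verts p). graph_degree G w = 2"
    using p by (auto simp: graph_segment_def)
  note walk = D.awalkI_apath[OF uv(1)]
  note dist = apath_distinct[OF uv(1)]
  have finS: "finite S" using fin by (simp add: S_def)
  have degS: "graph_degree G w = card S" unfolding S_def by (rule graph_degree_darts[OF fin])
  have "w \<in> verts G" using a by (auto simp: w_def split: if_splits)
  define T where "T = {d \<in> set p. src d = w}"
  define H where "H = {d \<in> set p. tgt d = w}"
  have BTH: "B = T \<union> rev_dart ` H"
  proof
    show "B \<subseteq> T \<union> rev_dart ` H"
    proof
      fix b assume b: "b \<in> B"
      then obtain d where d: "d \<in> set p" "fst b = fst d" by (auto simp: B_def)
      then have "b = d \<or> b = rev_dart d" by (simp add: fst_dart_eq_iff)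
      then show "b \<in> T \<union> rev_dart ` H" using b d(1) by (auto simp: B_def T_def H_def)
    qed
    show "T \<union> rev_dart ` H \<subseteq> B"
    proof
      fix b assume "b \<in> T \<union> rev_dart ` H"
      then show "b \<in> B"
      proof
        assume "b \<in> rev_dart ` H"
        then obtain d where "b = rev_dart d" "d \<in> set p" "tgt d = w"
          unfolding H_def by blast
        then show ?thesis by (simp add: B_def mem_Times_iff)
      qed (simp add: B_def T_def mem_Times_iff)
    qed
  qed
  have card1: "card T \<le> 1" "card H \<le> 1"
    using dist(1,2) by (auto simp: T_def H_def card_le_Suc0_iff_eq distinct_map inj_on_def)
  have finTH: "finite T" "finite H" by (auto simp: T_def H_def)
  have "set p \<subseteq> arcs (darts G)" using walk by blast
  then have BS: "B \<subseteq> S" by (force simp: B_def S_def mem_Times_iff)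
  have "2 \<le> card (S - B)"
  \<comment> \<open>Both sets are nonempty only if \<open>w\<close> is an inner vertex of the
    segment.\<close>
  proof (cases "T = {} \<or> H = {}")
    case True
    have "card B + 2 \<le> card S"
    proof (cases "T = {} \<and> H = {}")
      case True
      then show ?thesis using BTH deg \<open>w \<in> verts G\<close> degS by auto
    next
      case False
      have "w = u \<or> w = v"
      proof (cases "T = {}")
        case True
        then obtain d where "d \<in> set p" "tgt d = w" using False unfolding H_def by blast
        moreover have "w \<notin> src ` set p" using True unfolding T_def by blast
        ultimately show ?thesis using awalk_next[OF walk, of d] by blast
      next
        case T: False
        then obtain d where "d \<in> set p" "src d = w" unfolding T_def by blast
        moreover have "w \<notin> tgt ` set p" using True T unfolding H_def by blast
        ultimately show ?thesis using awalk_prev[OF walk, of d] by blast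
      qed
      then have "3 \<le> card S" using uv(2,3) degS by auto
      moreover have "card B \<le> 1"
        using True card1 card_image_le[OF finTH(2), of rev_dart] by (auto simp: BTH)
      ultimately show ?thesis by simp
    qed
    then show ?thesis using card_Diff_subset[OF finite_subset[OF BS finS] BS] by simp
  next
    case False
    then obtain d d' where d: "d \<in> set p" "src d = w" "d' \<in> set p" "tgt d' = w"
      unfolding T_def H_def by blast
    \<comment> \<open>Since \<open>p\<close> enters \<open>w\<close>, the dart leaving
      \<open>w\<close> is not the first one, so \<open>w\<close> is inner and has degree two. The
      segment then uses every dart at \<open>w\<close>, contradicting the choice of
      \<open>a\<close>.\<close>
    have "w \<noteq> u" using dist(3) d(3,4) by auto
    then have "d \<in> set (tl p)" using walk d by (cases p) (auto simp: D.awalk_Cons_iff)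
    then have "w \<in> set (D.inner_verts p)" using d(2) by (auto simp: D.inner_verts_def simp flip: map_tl)
    then have "card S = 2" using inner degS by auto
    moreover have "d \<noteq> rev_dart d'"
    proof
      assume *: "d = rev_dart d'"
      then have "fst d = fst d'" by simp
      then have "d = d'" using dist(5) d(1,3) unfolding distinct_map by (blast dest: inj_onD)
      with * show False by simp
    qed
    then have "2 \<le> card B"
      using d finite_subset[OF BS finS] by (intro card_ge_2I[of B d "rev_dart d'"]) (auto simp: BTH T_def H_def)
    ultimately have "B = S" using card_subset_eq[OF finS BS] card_mono[OF finS BS] by simp
    moreover have "a \<in> S" "a \<notin> B" using a by (auto simp: S_def B_def w_def)
    ultimately show ?thesis by simp
  qed
  moreover have "S - B = {b \<in> (arcs G - fst ` set p) \<times> UNIV. src b = src a}"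
    by (auto simp: S_def B_def w_def)
  ultimately show ?thesis by simp
qed

end

theorem theorem1p6:
  fixes \<Gamma> \<Gamma>' :: "('v, 'e) pre_digraph" and len :: "'e \<Rightarrow> real"
  assumes "metric_graph \<Gamma> len"
    and "subgraph \<Gamma>' \<Gamma>"
    and "fin_digraph \<Gamma>'"
    and "\<forall>v \<in> verts \<Gamma>'. 2 \<le> graph_degree \<Gamma>' v"
    and "ereal (2 * pi) \<le> girth \<Gamma> len"
    and "\<forall>x \<in> graph_points \<Gamma>' len. \<forall>y \<in> graph_points \<Gamma>' len. path_dist \<Gamma> len x y \<le> ereal pi"
  shows "(\<forall>p. graph_cycle \<Gamma>' p \<longrightarrow> commensurable_pi (edge_path_length len p)) \<and>
         (\<forall>p. graph_segment \<Gamma>' p \<longrightarrow> commensurable_pi (edge_path_length len p))"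
proof -
  interpret \<Gamma>: metric_graph \<Gamma> len by (rule assms(1))
  interpret \<Gamma>': fin_digraph \<Gamma>' by (rule assms(3))
  have sub: "arcs \<Gamma>' \<subseteq> arcs \<Gamma>" "tail \<Gamma>' = tail \<Gamma>" "head \<Gamma>' = head \<Gamma>"
    using assms(2) by (auto simp: subgraph_def compatible_def)
  interpret \<Gamma>': metric_graph \<Gamma>' len
    using sub(1) \<Gamma>.len_pos finite_subset[OF image_mono[OF sub(1)] \<Gamma>.finite_lengths]
    by unfold_locales auto
  have tail: "tail (darts \<Gamma>') = tail (darts \<Gamma>)" unfolding darts_def sub by simp
  have total: "commensurable_pi (sum len F)"
    if F: "F \<subseteq> arcs \<Gamma>'" and star: "\<And>a. a \<in> F \<times> UNIV \<Longrightarrow>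
      2 \<le> card {b \<in> F \<times> UNIV. tail (darts \<Gamma>') b = tail (darts \<Gamma>') a}" for F
  proof -
    \<comment> \<open>The diameter bound passes to every subset of the points, as distances remain
      those of \<open>\<Gamma>\<close>.\<close>
    have pts: "Vertex ` tail (darts \<Gamma>) ` (F \<times> UNIV) \<union> {Inner e t |e t. e \<in> F \<and> 0 < t \<and> t < len e}
        \<subseteq> graph_points \<Gamma>' len"
      using F unfolding tail[symmetric] by (auto simp: graph_points_def split: if_splits)
    interpret pi_diameter \<Gamma> len F
    proof unfold_locales
      show "F \<subseteq> arcs \<Gamma>" using F sub(1) by blast
      show "finite F" by (rule finite_subset[OF F \<Gamma>'.finite_arcs])
      show "2 \<le> card {b \<in> F \<times> UNIV. tail (darts \<Gamma>) b = tail (darts \<Gamma>) a}" if "a \<in> F \<times> UNIV" for a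
        using star[OF that] by (simp only: tail)
    qed (use assms(5,6) pts in blast)+
    show ?thesis by (rule total_length_commensurable)
  qed
  show ?thesis
  proof (intro conjI allI impI)
    fix p assume p: "graph_cycle \<Gamma>' p"
    then obtain u where "\<Gamma>'.D.awalk u p u" and dist: "distinct (map fst p)"
      by (auto simp: graph_cycle_def \<Gamma>'.D.cycle_def)
    then have "set p \<subseteq> arcs (darts \<Gamma>')" by blast
    then have "commensurable_pi (sum len (fst ` set p))"
      by (intro total \<Gamma>'.graph_cycle_star[OF p]) auto
    then show "commensurable_pi (edge_path_length len p)"
      by (simp add: edge_path_length_distinct dist)
  next
    fix p assume p: "graph_segment \<Gamma>' p"
    then obtain u v where uv: "\<Gamma>'.D.apath u p v" by (auto simp: graph_segment_def)
    then have "set p \<subseteq> arcs (darts \<Gamma>')" using \<Gamma>'.D.awalkI_apath by blast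
    then have edges: "fst ` set p \<subseteq> arcs \<Gamma>'" by auto
    have "2 \<le> card {b \<in> arcs \<Gamma>' \<times> UNIV. tail (darts \<Gamma>') b = tail (darts \<Gamma>') a}"
      if "a \<in> arcs \<Gamma>' \<times> UNIV" for a
      using assms(4) graph_degree_darts[OF \<Gamma>'.finite_arcs] \<Gamma>'.D.tail_in_verts[of a] that by simp
    then have "commensurable_pi (sum len (arcs \<Gamma>'))" by (rule total[OF subset_refl])
    moreover have "commensurable_pi (sum len (arcs \<Gamma>' - fst ` set p))"
      using \<Gamma>'.graph_segment_complement_star[OF \<Gamma>'.finite_arcs assms(4) p]
      by (intro total) auto
    moreover have "sum len (fst ` set p) = sum len (arcs \<Gamma>') - sum len (arcs \<Gamma>' - fst ` set p)"
      using sum.subset_diff[OF edges \<Gamma>'.finite_arcs, of len] by simp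
    ultimately have "commensurable_pi (sum len (fst ` set p))"
      unfolding commensurable_pi_def by (metis Rats_diff left_diff_distrib)
    then show "commensurable_pi (edge_path_length len p)"
      by (simp add: edge_path_length_distinct \<Gamma>'.apath_distinct(5)[OF uv])
  qed
qed

end
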